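(* Let $\{Z_n\}_{n\in\mathbb{N}}$ be a sequence of diagonal matrices $Z_n=\mathrm{diag}(z_1^{(n)},\ldots,z_n^{(n)})$ with $z_j^{(n)}\geq 1$ having bounded squeezing of degree $\zeta$ with $0\leq\zeta<1$, and assume that the average energy $\lambda(n)=\frac{1}{2n}\sum_{j=1}^n (z_j^{(n)}+1/z_j^{(n)})$ is uniformly bounded in $n$. Let $\{k_n\}_{n\in\mathbb{N}}$ be a sequence of subsystem sizes bounded of degree $\kappa$ with $0\leq\kappa<1$, and write $k=k_n$. Then $$\mathbb{E}\big[(J_kM_{n,k}(U))^2\big]=\big(-\lambda(n)^2+O(n^{\kappa+\zeta-1})\big)I_{2k},$$ where the expectation is over $U$ drawn from the Haar measure on the unitary group $U(n)$.
   Context: For $m\in\mathbb{N}$ let $J_m=\begin{pmatrix}0_m&-I_m\\ I_m&0_m\end{pmatrix}$. For $U\in U(n)$ let $\eta(U)=\begin{pmatrix}\mathrm{Re}(U)&\mathrm{Im}(U)\\ -\mathrm{Im}(U)&\mathrm{Re}(U)\end{pmatrix}\in\mathbb{R}^{2n\times 2n}$ (an orthogonal symplectic matrix). Set $\hat Z_n=Z_n\oplus Z_n^{-1}$ and $M_n(U)=\eta(U)\hat Z_n\eta(U)^T$. For $1\leq k\leq n$, $M_{n,k}(U)$ denotes the $2k\times 2k$ submatrix of $M_n(U)$ with rows and columns indexed by $\{1,\ldots,k\}\cup\{n+1,\ldots,n+k\}$ (in this order); it is the covariance matrix of the reduced state on the first $k$ modes of the pure Gaussian state with covariance matrix $M_n(U)$.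 A sequence $\{Z_n\}$ has bounded squeezing of degree $\zeta\ge 0$ if there is $C>0$ with $\|Z_n\|_\infty\leq Cn^\zeta$ for all large enough $n$. A sequence $\{k_n\}$ with $k_n\in\{1,\ldots,n\}$ is bounded of degree $\kappa\geq 0$ if there is $K>0$ with $k_n\leq Kn^\kappa$ for all large enough $n$. *)

theory Defs
  imports "HOL-Probability.Probability"
begin

text \<open>Square complex matrices of size n are functions nat => nat => complex,
  extensional on indices {..<n} (0-based). The measurable space is the finite
  product of Borel sigma-algebras on the n*n entries.\<close>

definition mat_space :: "nat \<Rightarrow> (nat \<Rightarrow> nat \<Rightarrow> complex) measure" where
  "mat_space n = (\<Pi>\<^sub>M i\<in>{..<n}. \<Pi>\<^sub>M j\<in>{..<n}. (borel :: complex measure))"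

definition cmul :: "nat \<Rightarrow> (nat \<Rightarrow> nat \<Rightarrow> complex) \<Rightarrow> (nat \<Rightarrow> nat \<Rightarrow> complex) \<Rightarrow> (nat \<Rightarrow> nat \<Rightarrow> complex)" where
  "cmul n A B = (\<lambda>i\<in>{..<n}. \<lambda>j\<in>{..<n}. \<Sum>l<n. A i l * B l j)"

definition cadj :: "nat \<Rightarrow> (nat \<Rightarrow> nat \<Rightarrow> complex) \<Rightarrow> (nat \<Rightarrow> nat \<Rightarrow> complex)" where
  "cadj n A = (\<lambda>i\<in>{..<n}. \<lambda>j\<in>{..<n}. cnj (A j i))"

definition cid :: "nat \<Rightarrow> (nat \<Rightarrow> nat \<Rightarrow> complex)" where
  "cid n = (\<lambda>i\<in>{..<n}. \<lambda>j\<in>{..<n}. if i = j then 1 else 0)"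

definition unitary_mat :: "nat \<Rightarrow> (nat \<Rightarrow> nat \<Rightarrow> complex) \<Rightarrow> bool" where
  "unitary_mat n U \<longleftrightarrow> U \<in> space (mat_space n) \<and> cmul n (cadj n U) U = cid n"

text \<open>Haar (probability) measure on U(n): a probability measure on n x n complex
  matrices concentrated on U(n) and invariant under left multiplication by unitaries.
  (It exists and is unique.)\<close>

definition haar_unitary :: "nat \<Rightarrow> (nat \<Rightarrow> nat \<Rightarrow> complex) measure \<Rightarrow> bool" where
  "haar_unitary n \<mu> \<longleftrightarrow> prob_space \<mu> \<and> sets \<mu> = sets (mat_space n)
     \<and> (AE U in \<mu>. unitary_mat n U)
     \<and> (\<forall>V. unitary_mat n V \<longrightarrow> distr \<mu> (mat_space n) (cmul n V) = \<mu>)"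

definition rmul :: "nat \<Rightarrow> (nat \<Rightarrow> nat \<Rightarrow> real) \<Rightarrow> (nat \<Rightarrow> nat \<Rightarrow> real) \<Rightarrow> (nat \<Rightarrow> nat \<Rightarrow> real)" where
  "rmul m A B = (\<lambda>i j. \<Sum>l<m. A i l * B l j)"

definition eta :: "nat \<Rightarrow> (nat \<Rightarrow> nat \<Rightarrow> complex) \<Rightarrow> (nat \<Rightarrow> nat \<Rightarrow> real)" where
  "eta n U = (\<lambda>a b.
     if a < n \<and> b < n then Re (U a b)
     else if a < n \<and> n \<le> b \<and> b < 2*n then Im (U a (b - n))
     else if n \<le> a \<and> a < 2*n \<and> b < n then - Im (U (a - n) b)
     else if n \<le> a \<and> a < 2*n \<and> n \<le> b \<and> b < 2*n then Re (U (a - n) (b - n))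
     else 0)"

definition Zhat :: "nat \<Rightarrow> (nat \<Rightarrow> nat \<Rightarrow> real) \<Rightarrow> (nat \<Rightarrow> nat \<Rightarrow> real)" where
  "Zhat n z = (\<lambda>a b. if a \<noteq> b then 0
      else if a < n then z n a
      else if a < 2*n then 1 / z n (a - n) else 0)"

definition transp_r :: "(nat \<Rightarrow> nat \<Rightarrow> real) \<Rightarrow> (nat \<Rightarrow> nat \<Rightarrow> real)" where
  "transp_r A = (\<lambda>i j. A j i)"

definition Mmat :: "nat \<Rightarrow> (nat \<Rightarrow> nat \<Rightarrow> real) \<Rightarrow> (nat \<Rightarrow> nat \<Rightarrow> complex) \<Rightarrow> (nat \<Rightarrow> nat \<Rightarrow> real)" where
  "Mmat n z U = rmul (2*n) (rmul (2*n) (eta n U) (Zhat n z)) (transp_r (eta n U))"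

text \<open>Index map {0..<2k} -> rows/cols {1..k} u {n+1..n+k} (0-based, in order).\<close>

definition red_idx :: "nat \<Rightarrow> nat \<Rightarrow> nat \<Rightarrow> nat" where
  "red_idx n k i = (if i < k then i else n + (i - k))"

definition Mred :: "nat \<Rightarrow> nat \<Rightarrow> (nat \<Rightarrow> nat \<Rightarrow> real) \<Rightarrow> (nat \<Rightarrow> nat \<Rightarrow> complex) \<Rightarrow> (nat \<Rightarrow> nat \<Rightarrow> real)" where
  "Mred n k z U = (\<lambda>i j. if i < 2*k \<and> j < 2*k then Mmat n z U (red_idx n k i) (red_idx n k j) else 0)"

definition Jmat :: "nat \<Rightarrow> (nat \<Rightarrow> nat \<Rightarrow> real)" where
  "Jmat k = (\<lambda>i j. if i < k \<and> j = i + k then -1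
                   else if k \<le> i \<and> i < 2*k \<and> i = j + k then 1 else 0)"

definition avg_energy :: "(nat \<Rightarrow> nat \<Rightarrow> real) \<Rightarrow> nat \<Rightarrow> real" where
  "avg_energy z n = (1 / (2 * real n)) * (\<Sum>j<n. z n j + 1 / z n j)"

end

theory Submission
  imports Defs
begin

text \<open>
  Write \<open>P = U p U\<^sup>*\<close> and \<open>Q = U q U\<^sup>T\<close> with \<open>p = (Z + Z\<^sup>-\<^sup>1) / 2\<close> and \<open>q = (Z - Z\<^sup>-\<^sup>1) / 2\<close>.
  Viewed as a real-linear map on the complex vectors of length \<open>k\<close>, the square of \<open>J M\<close> has the
  complex-linear part \<open>Q\<^sub>k cnj Q\<^sub>k - P\<^sub>k P\<^sub>k\<close> and, up to sign, the antilinear part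
  \<open>P\<^sub>k Q\<^sub>k - Q\<^sub>k cnj P\<^sub>k\<close>, where the index \<open>k\<close> denotes the leading block. Replacing \<open>U\<close> by
  \<open>\<i> U\<close> changes the sign of the antilinear part, and changing the sign of a row of \<open>U\<close> kills the
  off-diagonal entries of the linear part, whose diagonal is constant by permutation invariance.

  The second moments of the entries of \<open>P\<close> and \<open>Q\<close> follow without fourth-moment formulas for \<open>U\<close>. Let \<open>D\<close> and \<open>G\<close> be
  the expected squared moduli of a diagonal and of an off-diagonal entry. The Frobenius norm gives
  \<open>n D + n (n - 1) G = \<Sum> w\<^sup>2\<close> with \<open>w = p\<close> or \<open>w = q\<close>. Invariance under the rotation of two rows by
  45 degrees gives \<open>D = 2 G\<close> for \<open>Q\<close>, and for \<open>P\<close>, combined with the deterministic trace,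
  \<open>n\<^sup>2 D = (\<Sum> p)\<^sup>2 + n (n - 1) G\<close>. Hence the error is at most \<open>2 k\<close> times the sum of the two
  off-diagonal moments, which are bounded by \<open>\<Sum> p\<^sup>2 / (n (n - 1))\<close>.
\<close>

section \<open>Rearrangement of finite sums\<close>

lemma sum_lessThan_double:
  fixes f :: "nat \<Rightarrow> 'a::comm_monoid_add"
  shows "(\<Sum>c<2*n. f c) = (\<Sum>l<n. f l) + (\<Sum>l<n. f (n + l))"
proof -
  have "{..<2*n} = {..<n} \<union> (+) n ` {..<n}"
  proof (intro set_eqI iffI)
    fix x assume "x \<in> {..<2*n}"
    then show "x \<in> {..<n} \<union> (+) n ` {..<n}"
      by (cases "x < n") (auto intro!: image_eqI[of _ _ "x - n"])
  qed auto
  moreover have "{..<n} \<inter> (+) n ` {..<n} = {}" by auto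
  ultimately show ?thesis
    by (simp add: sum.union_disjoint sum.reindex)
qed

lemma sum_swap_pairs:
  "(\<Sum>a\<in>A. \<Sum>b\<in>B. \<Sum>c\<in>C. \<Sum>d\<in>D. f a b c d) = (\<Sum>c\<in>C. \<Sum>d\<in>D. \<Sum>a\<in>A. \<Sum>b\<in>B. f a b c d)"
  by (subst (2) sum.swap, subst (1) sum.swap, subst (3) sum.swap, subst (2) sum.swap) (rule refl)

text \<open>Permutation invariance leaves a table of second moments only two values, one on and one
  off the diagonal. Row sums and total sums of such tables are counted here.\<close>

lemma sum_off_diagonal:
  fixes f :: "nat \<Rightarrow> nat \<Rightarrow> 'a::comm_ring_1"
  assumes "\<And>a. a < n \<Longrightarrow> f a a = D" "\<And>a b. a < n \<Longrightarrow> b < n \<Longrightarrow> a \<noteq> b \<Longrightarrow> f a b = G"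
  shows "a < n \<Longrightarrow> (\<Sum>b<n. f a b) = D + (of_nat n - 1) * G"
    and "(\<Sum>a<n. \<Sum>b<n. f a b) = of_nat n * D + of_nat n * (of_nat n - 1) * G"
proof -
  show *: "(\<Sum>b<n. f a b) = D + (of_nat n - 1) * G" if "a < n" for a
  proof -
    have "(\<Sum>b<n. f a b) = f a a + (\<Sum>b\<in>{..<n} - {a}. f a b)"
      using that by (simp add: sum.remove)
    also have "(\<Sum>b\<in>{..<n} - {a}. f a b) = (\<Sum>b\<in>{..<n} - {a}. G)"
      using assms(2) that by (intro sum.cong) auto
    also have "\<dots> = (of_nat n - 1) * G"
      using that by (simp add: of_nat_diff)
    finally show ?thesis using assms(1) that by simp
  qed
  show "(\<Sum>a<n. \<Sum>b<n. f a b) = of_nat n * D + of_nat n * (of_nat n - 1) * G"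
    using * by (simp add: ring_distribs mult.assoc)
qed

section \<open>Unitary matrices and bounded observables\<close>

lemma unitary_mat_iff:
  "unitary_mat n V \<longleftrightarrow> V \<in> space (mat_space n) \<and>
     (\<forall>l<n. \<forall>m<n. (\<Sum>a<n. cnj (V a l) * V a m) = (if l = m then 1 else 0))"
proof -
  have "cmul n (cadj n V) V = cid n \<longleftrightarrow>
     (\<forall>l<n. \<forall>m<n. (\<Sum>a<n. cnj (V a l) * V a m) = (if l = m then 1 else 0))"
    (is "?L \<longleftrightarrow> ?R")
  proof
    assume ?L
    show ?R
    proof (intro allI impI)
      fix l m assume "l < n" "m < n"
      with \<open>?L\<close> have "cmul n (cadj n V) V l m = cid n l m" by simp
      with \<open>l < n\<close> \<open>m < n\<close> show "(\<Sum>a<n. cnj (V a l) * V a m) = (if l = m then 1 else 0)"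
        by (simp add: cmul_def cadj_def cid_def)
    qed
  next
    assume ?R
    then show ?L
      by (auto simp: cmul_def cadj_def cid_def fun_eq_iff restrict_def)
  qed
  then show ?thesis by (simp add: unitary_mat_def)
qed

lemma restrict_in_mat_space:
  "(\<lambda>i\<in>{..<n}. \<lambda>j\<in>{..<n}. f i j) \<in> space (mat_space n)"
  by (auto simp: mat_space_def space_PiM)

text \<open>Every column of a unitary matrix is a unit vector. This bound is what makes polynomials
  in the entries integrable.\<close>

lemma cmod_unitary_entry_le_1:
  assumes "unitary_mat n U" "a < n" "l < n"
  shows "cmod (U a l) \<le> 1"
proof -
  have "(\<Sum>a<n. cnj (U a l) * U a l) = 1"
    using assms by (simp add: unitary_mat_iff)
  moreover have "cnj (U a l) * U a l = of_real ((cmod (U a l))\<^sup>2)" for a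
    using complex_norm_square[of "U a l"] by (simp add: mult.commute)
  ultimately have "complex_of_real (\<Sum>a<n. (cmod (U a l))\<^sup>2) = 1" by simp
  then have "(\<Sum>a<n. (cmod (U a l))\<^sup>2) = 1"
    using of_real_eq_1_iff by blast
  moreover have "(cmod (U a l))\<^sup>2 \<le> (\<Sum>a<n. (cmod (U a l))\<^sup>2)"
    using assms by (intro member_le_sum) auto
  ultimately show ?thesis
    by (simp add: power_le_one_iff)
qed

text \<open>Polynomials in the entries are unbounded on the whole matrix space, so the bound is
  asked for on unitary matrices only, where the Haar measure is concentrated. The class is an
  algebra closed under conjugation, and the rules \<open>bobs\<close> thus settle integrability
  syntactically.\<close>

definition bounded_obs :: "nat \<Rightarrow> ((nat \<Rightarrow> nat \<Rightarrow> complex) \<Rightarrow> complex) \<Rightarrow> bool" where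
  "bounded_obs n f \<longleftrightarrow> f \<in> borel_measurable (mat_space n) \<and>
     (\<exists>B. \<forall>U. unitary_mat n U \<longrightarrow> cmod (f U) \<le> B)"

named_theorems bobs

lemma bounded_obs_const [bobs]: "bounded_obs n (\<lambda>U. c)"
  by (auto simp: bounded_obs_def)

lemma bounded_obs_entry [bobs]:
  assumes "a < n" "l < n"
  shows "bounded_obs n (\<lambda>U. U a l)"
proof -
  have "(\<lambda>U. U a l) \<in> borel_measurable (mat_space n)"
    unfolding mat_space_def using assms
    by (intro measurable_compose[OF measurable_component_singleton[of a]]
        measurable_component_singleton) auto
  then show ?thesis
    using cmod_unitary_entry_le_1 assms unfolding bounded_obs_def by blast
qed

lemma bounded_obs_add [bobs]:
  assumes "bounded_obs n f" "bounded_obs n g"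
  shows "bounded_obs n (\<lambda>U. f U + g U)"
proof -
  obtain B C where "\<And>U. unitary_mat n U \<Longrightarrow> cmod (f U) \<le> B" "\<And>U. unitary_mat n U \<Longrightarrow> cmod (g U) \<le> C"
    using assms unfolding bounded_obs_def by blast
  then have "unitary_mat n U \<Longrightarrow> cmod (f U + g U) \<le> B + C" for U
    by (meson norm_triangle_mono)
  then show ?thesis
    using assms by (auto simp: bounded_obs_def)
qed

lemma bounded_obs_mult [bobs]:
  assumes "bounded_obs n f" "bounded_obs n g"
  shows "bounded_obs n (\<lambda>U. f U * g U)"
proof -
  obtain B C where "\<And>U. unitary_mat n U \<Longrightarrow> cmod (f U) \<le> B" "\<And>U. unitary_mat n U \<Longrightarrow> cmod (g U) \<le> C"
    using assms unfolding bounded_obs_def by blast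
  then have "unitary_mat n U \<Longrightarrow> cmod (f U * g U) \<le> B * C" for U
    unfolding norm_mult by (meson mult_mono' norm_ge_zero)
  then show ?thesis
    using assms by (auto simp: bounded_obs_def)
qed

lemma bounded_obs_cnj [bobs]:
  assumes "bounded_obs n f"
  shows "bounded_obs n (\<lambda>U. cnj (f U))"
proof -
  have "cnj \<in> borel_measurable borel"
    by (intro borel_measurable_continuous_onI continuous_intros)
  then show ?thesis
    using assms by (auto simp: bounded_obs_def intro: measurable_compose)
qed

lemma bounded_obs_uminus [bobs]: "bounded_obs n f \<Longrightarrow> bounded_obs n (\<lambda>U. - f U)"
  by (auto simp: bounded_obs_def)

lemma bounded_obs_diff [bobs]:
  "bounded_obs n f \<Longrightarrow> bounded_obs n g \<Longrightarrow> bounded_obs n (\<lambda>U. f U - g U)"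
  using bounded_obs_add[OF _ bounded_obs_uminus, of n f g] by simp

lemma bounded_obs_sum [bobs]:
  "(\<And>i. i \<in> I \<Longrightarrow> bounded_obs n (f i)) \<Longrightarrow> bounded_obs n (\<lambda>U. \<Sum>i\<in>I. f i U)"
  by (induction I rule: infinite_finite_induct) (auto intro: bobs)

section \<open>The Hermitian matrix U diag(w) U^H and the complex symmetric matrix U diag(w)
  U^T\<close>

definition herm_conj :: "nat \<Rightarrow> (nat \<Rightarrow> real) \<Rightarrow> (nat \<Rightarrow> nat \<Rightarrow> complex) \<Rightarrow> nat \<Rightarrow> nat \<Rightarrow> complex" where
  "herm_conj n w U a b = (\<Sum>l<n. of_real (w l) * U a l * cnj (U b l))"

definition sym_conj :: "nat \<Rightarrow> (nat \<Rightarrow> real) \<Rightarrow> (nat \<Rightarrow> nat \<Rightarrow> complex) \<Rightarrow> nat \<Rightarrow> nat \<Rightarrow> complex" where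
  "sym_conj n w U a b = (\<Sum>l<n. of_real (w l) * U a l * U b l)"

lemma bounded_obs_herm_conj [bobs]:
  "a < n \<Longrightarrow> b < n \<Longrightarrow> bounded_obs n (\<lambda>U. herm_conj n w U a b)"
  unfolding herm_conj_def by (intro bobs) auto

lemma bounded_obs_sym_conj [bobs]:
  "a < n \<Longrightarrow> b < n \<Longrightarrow> bounded_obs n (\<lambda>U. sym_conj n w U a b)"
  unfolding sym_conj_def by (intro bobs) auto

lemma cnj_herm_conj: "cnj (herm_conj n w U a b) = herm_conj n w U b a"
  by (simp add: herm_conj_def mult_ac)

lemma sym_conj_commute: "sym_conj n w U a b = sym_conj n w U b a"
  by (simp add: sym_conj_def mult_ac)

lemma trace_herm_conj:
  assumes "unitary_mat n U"
  shows "(\<Sum>a<n. herm_conj n w U a a) = of_real (\<Sum>l<n. w l)"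
proof -
  have "(\<Sum>a<n. herm_conj n w U a a) = (\<Sum>l<n. of_real (w l) * (\<Sum>a<n. cnj (U a l) * U a l))"
    unfolding herm_conj_def sum_distrib_left by (subst sum.swap) (simp add: mult_ac)
  then show ?thesis using assms by (simp add: unitary_mat_iff)
qed

text \<open>After expanding the squared moduli and summing over the row indices \<open>a\<close>,
  \<open>b\<close> first, the inner sums are inner products of columns of \<open>U\<close>.
  Orthonormality leaves only the terms with \<open>l = m\<close>.\<close>

lemma frobenius_herm_conj:
  assumes "unitary_mat n U"
  shows "(\<Sum>a<n. \<Sum>b<n. herm_conj n w U a b * cnj (herm_conj n w U a b)) = of_real (\<Sum>l<n. (w l)\<^sup>2)"
proof -
  have "(\<Sum>a<n. \<Sum>b<n. herm_conj n w U a b * cnj (herm_conj n w U a b))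
     = (\<Sum>a<n. \<Sum>b<n. \<Sum>l<n. \<Sum>m<n. of_real (w l * w m) *
          (cnj (U a m) * U a l) * (cnj (U b l) * U b m))"
    by (simp add: herm_conj_def sum_product mult_ac)
  also have "\<dots> = (\<Sum>l<n. \<Sum>m<n. \<Sum>a<n. \<Sum>b<n. of_real (w l * w m) *
          (cnj (U a m) * U a l) * (cnj (U b l) * U b m))"
    by (rule sum_swap_pairs)
  also have "\<dots> = (\<Sum>l<n. \<Sum>m<n. of_real (w l * w m) *
          (\<Sum>a<n. cnj (U a m) * U a l) * (\<Sum>b<n. cnj (U b l) * U b m))"
    by (simp add: sum_product sum_distrib_left mult_ac)
  also have "\<dots> = (\<Sum>l<n. \<Sum>m<n. if m = l then of_real (w l * w m) else 0)"
    using assms by (intro sum.cong refl) (auto simp: unitary_mat_iff)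
  also have "\<dots> = of_real (\<Sum>l<n. (w l)\<^sup>2)"
    by (simp add: power2_eq_square)
  finally show ?thesis .
qed

lemma frobenius_sym_conj:
  assumes "unitary_mat n U"
  shows "(\<Sum>a<n. \<Sum>b<n. sym_conj n w U a b * cnj (sym_conj n w U a b)) = of_real (\<Sum>l<n. (w l)\<^sup>2)"
proof -
  have "(\<Sum>a<n. \<Sum>b<n. sym_conj n w U a b * cnj (sym_conj n w U a b))
     = (\<Sum>a<n. \<Sum>b<n. \<Sum>l<n. \<Sum>m<n. of_real (w l * w m) *
          (cnj (U a m) * U a l) * (cnj (U b m) * U b l))"
    by (simp add: sym_conj_def sum_product mult_ac)
  also have "\<dots> = (\<Sum>l<n. \<Sum>m<n. \<Sum>a<n. \<Sum>b<n. of_real (w l * w m) *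
          (cnj (U a m) * U a l) * (cnj (U b m) * U b l))"
    by (rule sum_swap_pairs)
  also have "\<dots> = (\<Sum>l<n. \<Sum>m<n. of_real (w l * w m) *
          (\<Sum>a<n. cnj (U a m) * U a l) * (\<Sum>b<n. cnj (U b m) * U b l))"
    by (simp add: sum_product sum_distrib_left mult_ac)
  also have "\<dots> = (\<Sum>l<n. \<Sum>m<n. if m = l then of_real (w l * w m) else 0)"
    using assms by (intro sum.cong refl) (auto simp: unitary_mat_iff)
  also have "\<dots> = of_real (\<Sum>l<n. (w l)\<^sup>2)"
    by (simp add: power2_eq_square)
  finally show ?thesis .
qed

section \<open>Phases, permutations and a rotation\<close>

definition phase_mat :: "nat \<Rightarrow> (nat \<Rightarrow> complex) \<Rightarrow> nat \<Rightarrow> nat \<Rightarrow> complex" where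
  "phase_mat n d = (\<lambda>i\<in>{..<n}. \<lambda>j\<in>{..<n}. if i = j then d i else 0)"

definition perm_mat :: "nat \<Rightarrow> (nat \<Rightarrow> nat) \<Rightarrow> nat \<Rightarrow> nat \<Rightarrow> complex" where
  "perm_mat n \<sigma> = (\<lambda>i\<in>{..<n}. \<lambda>j\<in>{..<n}. if j = \<sigma> i then 1 else 0)"

text \<open>For \<open>n >= 2\<close>, the rotation by 45 degrees in the plane of the indices 0 and
  1. Unlike phases and permutations, it mixes diagonal with off-diagonal entries of the conjugated
  matrices and so relates their moments.\<close>

definition rot_mat :: "nat \<Rightarrow> nat \<Rightarrow> nat \<Rightarrow> complex" where
  "rot_mat n = (\<lambda>i\<in>{..<n}. \<lambda>j\<in>{..<n}.
     if i < 2 \<and> j < 2 then (if i = 1 \<and> j = 0 then -1 else 1) / of_real (sqrt 2)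
     else if i = j then 1 else 0)"

lemma unitary_phase_mat:
  assumes "\<And>i. i < n \<Longrightarrow> cnj (d i) * d i = 1"
  shows "unitary_mat n (phase_mat n d)"
  unfolding unitary_mat_iff
proof (intro conjI allI impI)
  fix l m assume lm: "l < n" "m < n"
  have "(\<Sum>a<n. cnj (phase_mat n d a l) * phase_mat n d a m)
      = (\<Sum>a<n. if a = l then (if l = m then cnj (d l) * d l else 0) else 0)"
    using lm by (intro sum.cong) (auto simp: phase_mat_def)
  then show "(\<Sum>a<n. cnj (phase_mat n d a l) * phase_mat n d a m) = (if l = m then 1 else 0)"
    using lm assms by simp
qed (auto simp: phase_mat_def restrict_in_mat_space)

lemma unitary_perm_mat:
  assumes "\<sigma> permutes {..<n}"
  shows "unitary_mat n (perm_mat n \<sigma>)"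
  unfolding unitary_mat_iff
proof (intro conjI allI impI)
  fix l m assume lm: "l < n" "m < n"
  have "(\<Sum>a<n. cnj (perm_mat n \<sigma> a l) * perm_mat n \<sigma> a m)
      = (\<Sum>a<n. (\<lambda>b. if b = l then (if l = m then 1 else 0) else 0) (\<sigma> a))"
    using lm by (intro sum.cong) (auto simp: perm_mat_def)
  also have "\<dots> = (\<Sum>b<n. if b = l then (if l = m then 1 else 0) else 0)"
    using sum.permute[OF assms, of "\<lambda>b. if b = l then (if l = m then 1 else 0) else 0 :: complex"]
    by (simp only: o_def)
  finally show "(\<Sum>a<n. cnj (perm_mat n \<sigma> a l) * perm_mat n \<sigma> a m) = (if l = m then 1 else 0)"
    using lm by simp
qed (auto simp: perm_mat_def restrict_in_mat_space)

lemma unitary_rot_mat: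
  assumes "n \<ge> 2"
  shows "unitary_mat n (rot_mat n)"
  unfolding unitary_mat_iff
proof (intro conjI allI impI)
  fix l m assume lm: "l < n" "m < n"
  have s: "complex_of_real (sqrt 2) * complex_of_real (sqrt 2) = 2"
    by (simp flip: of_real_mult)
  have split: "{..<n} = {0, 1} \<union> {2..<n}" using assms by auto
  have "(\<Sum>a<n. cnj (rot_mat n a l) * rot_mat n a m)
      = cnj (rot_mat n 0 l) * rot_mat n 0 m + cnj (rot_mat n 1 l) * rot_mat n 1 m
        + (\<Sum>a=2..<n. cnj (rot_mat n a l) * rot_mat n a m)"
    unfolding split by (subst sum.union_disjoint) auto
  also have "(\<Sum>a=2..<n. cnj (rot_mat n a l) * rot_mat n a m)
      = (\<Sum>a=2..<n. if a = l then (if l = m then 1 else 0) else 0)"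
    using lm by (intro sum.cong) (auto simp: rot_mat_def)
  finally show "(\<Sum>a<n. cnj (rot_mat n a l) * rot_mat n a m) = (if l = m then 1 else 0)"
    using lm assms
    by (cases "l < 2"; cases "m < 2") (auto simp: rot_mat_def less_2_cases_iff s)
qed (auto simp: rot_mat_def restrict_in_mat_space)

section \<open>Action of the special unitaries on rows and on the two conjugations\<close>

lemma cmul_phase_mat:
  assumes "a < n" "l < n"
  shows "cmul n (phase_mat n d) U a l = d a * U a l"
proof -
  have "(\<Sum>c<n. phase_mat n d a c * U c l) = (\<Sum>c<n. if c = a then d a * U a l else 0)"
    using assms by (intro sum.cong) (auto simp: phase_mat_def)
  then show ?thesis using assms by (simp add: cmul_def)
qed

lemma cmul_perm_mat:
  assumes "a < n" "l < n" "\<sigma> a < n"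
  shows "cmul n (perm_mat n \<sigma>) U a l = U (\<sigma> a) l"
proof -
  have "(\<Sum>c<n. perm_mat n \<sigma> a c * U c l) = (\<Sum>c<n. if c = \<sigma> a then U (\<sigma> a) l else 0)"
    using assms by (intro sum.cong) (auto simp: perm_mat_def)
  then show ?thesis using assms by (simp add: cmul_def)
qed

lemma cmul_rot_mat_0:
  assumes "n \<ge> 2" "l < n"
  shows "cmul n (rot_mat n) U 0 l = (U 0 l + U 1 l) / of_real (sqrt 2)"
proof -
  have split: "{..<n} = {0, 1} \<union> {2..<n}" using assms by auto
  have "(\<Sum>c<n. rot_mat n 0 c * U c l) = rot_mat n 0 0 * U 0 l + rot_mat n 0 1 * U 1 l
      + (\<Sum>c=2..<n. rot_mat n 0 c * U c l)"
    unfolding split by (subst sum.union_disjoint) auto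
  also have "(\<Sum>c=2..<n. rot_mat n 0 c * U c l) = 0"
    using assms by (intro sum.neutral) (auto simp: rot_mat_def)
  finally show ?thesis using assms by (simp add: cmul_def rot_mat_def add_divide_distrib)
qed

text \<open>The second index enters with the conjugate phase in the Hermitian case and with the
  phase itself in the symmetric case. A global phase therefore fixes the former matrix but not the
  latter.\<close>

lemma conj_phase_mat:
  assumes "a < n" "b < n"
  shows "herm_conj n w (cmul n (phase_mat n d) U) a b = d a * cnj (d b) * herm_conj n w U a b"
    and "sym_conj n w (cmul n (phase_mat n d) U) a b = d a * d b * sym_conj n w U a b"
  using assms by (simp_all add: herm_conj_def sym_conj_def cmul_phase_mat sum_distrib_left mult_ac)

lemma conj_perm_mat:
  assumes "a < n" "b < n" "\<sigma> permutes {..<n}"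
  shows "herm_conj n w (cmul n (perm_mat n \<sigma>) U) a b = herm_conj n w U (\<sigma> a) (\<sigma> b)"
    and "sym_conj n w (cmul n (perm_mat n \<sigma>) U) a b = sym_conj n w U (\<sigma> a) (\<sigma> b)"
proof -
  have "\<sigma> a < n" "\<sigma> b < n" using assms permutes_in_image by fastforce+
  then show "herm_conj n w (cmul n (perm_mat n \<sigma>) U) a b = herm_conj n w U (\<sigma> a) (\<sigma> b)"
    and "sym_conj n w (cmul n (perm_mat n \<sigma>) U) a b = sym_conj n w U (\<sigma> a) (\<sigma> b)"
    using assms by (simp_all add: herm_conj_def sym_conj_def cmul_perm_mat)
qed

text \<open>The factor 2 clears the two factors \<open>1 / sqrt 2\<close>. The grouping separates
  the terms that are even under a sign change of row 1 (diagonal entries) from those that are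
  odd.\<close>

lemma conj_rot_mat:
  assumes "n \<ge> 2"
  shows "2 * herm_conj n w (cmul n (rot_mat n) U) 0 0 =
           (herm_conj n w U 0 0 + herm_conj n w U 1 1) + (herm_conj n w U 0 1 + herm_conj n w U 1 0)"
    and "2 * sym_conj n w (cmul n (rot_mat n) U) 0 0 =
           (sym_conj n w U 0 0 + sym_conj n w U 1 1) + 2 * sym_conj n w U 0 1"
proof -
  have s: "complex_of_real (sqrt 2) * complex_of_real (sqrt 2) = 2"
    by (simp flip: of_real_mult)
  show "2 * herm_conj n w (cmul n (rot_mat n) U) 0 0 =
           (herm_conj n w U 0 0 + herm_conj n w U 1 1) + (herm_conj n w U 0 1 + herm_conj n w U 1 0)"
    using assms
    by (simp add: herm_conj_def cmul_rot_mat_0 sum_distrib_left flip: sum.distrib)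
       (intro sum.cong refl, simp add: field_simps s)
  show "2 * sym_conj n w (cmul n (rot_mat n) U) 0 0 =
           (sym_conj n w U 0 0 + sym_conj n w U 1 1) + 2 * sym_conj n w U 0 1"
    using assms
    by (simp add: sym_conj_def cmul_rot_mat_0 sum_distrib_left flip: sum.distrib)
       (intro sum.cong refl, simp add: field_simps s)
qed

text \<open>A first transposition sends 0 to \<open>a\<close>; a second one moves the image of 1 to
  \<open>b\<close>. The second fixes \<open>a\<close>, because \<open>a\<close> differs both from
  \<open>b\<close> and from the image of 1.\<close>

lemma permutation_of_two:
  fixes a b n :: nat
  assumes "a < n" "b < n" "a \<noteq> b"
  obtains \<sigma> where "\<sigma> permutes {..<n}" "\<sigma> 0 = a" "\<sigma> 1 = b"
proof -
  define \<tau> where "\<tau> = Transposition.transpose 0 a"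
  define \<sigma> where "\<sigma> = Transposition.transpose (\<tau> 1) b \<circ> \<tau>"
  have n: "0 < n \<and> 1 < n" using assms by arith
  have "\<tau> permutes {..<n}" unfolding \<tau>_def using assms n by (intro permutes_swap_id) auto
  moreover from this have "\<tau> 1 < n" using n permutes_in_image by fastforce
  ultimately have "\<sigma> permutes {..<n}" unfolding \<sigma>_def
    using assms by (intro permutes_compose permutes_swap_id) auto
  moreover have "\<sigma> 0 = a" "\<sigma> 1 = b"
    using assms by (auto simp: \<sigma>_def \<tau>_def Transposition.transpose_def)
  ultimately show ?thesis using that by blast
qed

section \<open>Second moments under the Haar measure\<close>

text \<open>The bound on \<open>n\<close> provides the two distinct rows 0 and 1, which represent
  all pairs of distinct indices.\<close>

locale haar_measure =
  fixes n :: nat and \<mu> :: "(nat \<Rightarrow> nat \<Rightarrow> complex) measure"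
  assumes haar: "haar_unitary n \<mu>" and n2: "n \<ge> 2"
begin

sublocale prob_space \<mu>
  using haar by (simp add: haar_unitary_def)

lemma sets_eq: "sets \<mu> = sets (mat_space n)"
  using haar by (simp add: haar_unitary_def)

lemma AE_unitary: "AE U in \<mu>. unitary_mat n U"
  using haar by (simp add: haar_unitary_def)

lemma measurable_cmul: "cmul n V \<in> mat_space n \<rightarrow>\<^sub>M mat_space n"
proof -
  have "(\<lambda>U. \<Sum>l<n. V i l * U l j) \<in> borel_measurable (mat_space n)" if "i < n" "j < n" for i j
  proof -
    have "bounded_obs n (\<lambda>U. \<Sum>l<n. V i l * U l j)"
      using that by (intro bobs) auto
    then show ?thesis by (simp add: bounded_obs_def)
  qed
  then have "(\<lambda>U. \<lambda>i\<in>{..<n}. \<lambda>j\<in>{..<n}. \<Sum>l<n. V i l * U l j) \<in>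
      mat_space n \<rightarrow>\<^sub>M (\<Pi>\<^sub>M i\<in>{..<n}. \<Pi>\<^sub>M j\<in>{..<n}. borel)"
    by (intro measurable_restrict) auto
  then show ?thesis
    by (simp add: cmul_def[abs_def] mat_space_def)
qed

lemma measurable_obs: "bounded_obs n f \<Longrightarrow> f \<in> borel_measurable \<mu>"
  using measurable_cong_sets[OF sets_eq refl] by (auto simp: bounded_obs_def)

lemma integrable_obs:
  assumes "bounded_obs n f"
  shows "integrable \<mu> f"
proof -
  obtain B where "\<And>U. unitary_mat n U \<Longrightarrow> cmod (f U) \<le> B"
    using assms by (auto simp: bounded_obs_def)
  then show ?thesis
    using measurable_obs[OF assms] AE_unitary
    by (intro integrable_const_bound[where B = B]) auto
qed

abbreviation Ex :: "((nat \<Rightarrow> nat \<Rightarrow> complex) \<Rightarrow> complex) \<Rightarrow> complex" where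
  "Ex f \<equiv> integral\<^sup>L \<mu> f"

lemma Ex_invariant:
  assumes "unitary_mat n V" "bounded_obs n f"
  shows "Ex (\<lambda>U. f (cmul n V U)) = Ex f"
proof -
  have "distr \<mu> (mat_space n) (cmul n V) = \<mu>"
    using haar assms by (simp add: haar_unitary_def)
  moreover have "integral\<^sup>L (distr \<mu> (mat_space n) (cmul n V)) f = Ex (\<lambda>U. f (cmul n V U))"
    using assms measurable_cmul measurable_cong_sets[OF sets_eq refl]
    by (intro integral_distr) (auto simp: bounded_obs_def)
  ultimately show ?thesis by simp
qed

text \<open>By invariance the expectation equals its own negative. All vanishing moments below arise
  this way.\<close>

lemma Ex_odd_eq_0:
  assumes "unitary_mat n V" "bounded_obs n f" "\<And>U. f (cmul n V U) = - f U"
  shows "Ex f = 0"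
proof -
  have "Ex f = - Ex f"
    using Ex_invariant[OF assms(1,2)] assms(3) by simp
  then show ?thesis by simp
qed

lemma Ex_AE_const:
  assumes "bounded_obs n f" "\<And>U. unitary_mat n U \<Longrightarrow> f U = c"
  shows "Ex f = c"
proof -
  have "Ex f = Ex (\<lambda>U. c)"
    using measurable_obs[OF assms(1)] AE_unitary assms(2) by (intro integral_cong_AE) auto
  then show ?thesis by (simp add: prob_space)
qed

lemma Ex_sum:
  assumes "\<And>i. i \<in> I \<Longrightarrow> bounded_obs n (f i)"
  shows "Ex (\<lambda>U. \<Sum>i\<in>I. f i U) = (\<Sum>i\<in>I. Ex (f i))"
  using assms by (intro Bochner_Integration.integral_sum integrable_obs)

lemma Ex_add:
  "bounded_obs n f \<Longrightarrow> bounded_obs n g \<Longrightarrow> Ex (\<lambda>U. f U + g U) = Ex f + Ex g"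
  by (intro Bochner_Integration.integral_add integrable_obs)

lemma Ex_diff:
  "bounded_obs n f \<Longrightarrow> bounded_obs n g \<Longrightarrow> Ex (\<lambda>U. f U - g U) = Ex f - Ex g"
  by (intro Bochner_Integration.integral_diff integrable_obs)

lemma pos: "0 < n" "Suc 0 < n"
  using n2 by auto

text \<open>Representatives of the second moments up to permutation of the indices;
  \<open>herm_cross\<close> correlates two different diagonal entries. Squared moduli are written as
  \<open>f * cnj f\<close>, so that they expand algebraically over the complex numbers.\<close>

definition herm_diag where "herm_diag w = Ex (\<lambda>U. herm_conj n w U 0 0 * cnj (herm_conj n w U 0 0))"
definition herm_off where "herm_off w = Ex (\<lambda>U. herm_conj n w U 0 1 * cnj (herm_conj n w U 0 1))"
definition herm_cross where "herm_cross w = Ex (\<lambda>U. herm_conj n w U 0 0 * cnj (herm_conj n w U 1 1))"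
definition sym_diag where "sym_diag w = Ex (\<lambda>U. sym_conj n w U 0 0 * cnj (sym_conj n w U 0 0))"
definition sym_off where "sym_off w = Ex (\<lambda>U. sym_conj n w U 0 1 * cnj (sym_conj n w U 0 1))"

text \<open>Left multiplication by a permutation matrix sending the index pair 0, 1 to
  \<open>a\<close>, \<open>b\<close> turns the representative into the given moment.\<close>

lemma moments_off:
  assumes "a < n" "b < n" "a \<noteq> b"
  shows "Ex (\<lambda>U. herm_conj n w U a b * cnj (herm_conj n w U a b)) = herm_off w"
    and "Ex (\<lambda>U. herm_conj n w U a a * cnj (herm_conj n w U b b)) = herm_cross w"
    and "Ex (\<lambda>U. sym_conj n w U a b * cnj (sym_conj n w U a b)) = sym_off w"
proof -
  obtain \<sigma> where \<sigma>: "\<sigma> permutes {..<n}" "\<sigma> 0 = a" "\<sigma> 1 = b"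
    using permutation_of_two assms by blast
  show "Ex (\<lambda>U. herm_conj n w U a b * cnj (herm_conj n w U a b)) = herm_off w"
    unfolding herm_off_def using \<sigma> pos
    by (subst (2) Ex_invariant[OF unitary_perm_mat[OF \<sigma>(1)], symmetric])
       (auto intro!: bobs simp: conj_perm_mat)
  show "Ex (\<lambda>U. herm_conj n w U a a * cnj (herm_conj n w U b b)) = herm_cross w"
    unfolding herm_cross_def using \<sigma> pos
    by (subst (2) Ex_invariant[OF unitary_perm_mat[OF \<sigma>(1)], symmetric])
       (auto intro!: bobs simp: conj_perm_mat)
  show "Ex (\<lambda>U. sym_conj n w U a b * cnj (sym_conj n w U a b)) = sym_off w"
    unfolding sym_off_def using \<sigma> pos
    by (subst (2) Ex_invariant[OF unitary_perm_mat[OF \<sigma>(1)], symmetric])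
       (auto intro!: bobs simp: conj_perm_mat)
qed

lemma moments_diag:
  assumes "a < n"
  shows "Ex (\<lambda>U. herm_conj n w U a a * cnj (herm_conj n w U a a)) = herm_diag w"
    and "Ex (\<lambda>U. sym_conj n w U a a * cnj (sym_conj n w U a a)) = sym_diag w"
proof -
  \<comment> \<open>Any index other than \<open>a\<close> would do: only the image of 0 matters
    here.\<close>
  define b :: nat where "b = (if a = 0 then 1 else 0)"
  have "b < n" "a \<noteq> b" using pos by (auto simp: b_def)
  then obtain \<sigma> where \<sigma>: "\<sigma> permutes {..<n}" "\<sigma> 0 = a" "\<sigma> 1 = b"
    using permutation_of_two assms by blast
  show "Ex (\<lambda>U. herm_conj n w U a a * cnj (herm_conj n w U a a)) = herm_diag w"
    unfolding herm_diag_def using \<sigma> pos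
    by (subst (2) Ex_invariant[OF unitary_perm_mat[OF \<sigma>(1)], symmetric])
       (auto intro!: bobs simp: conj_perm_mat)
  show "Ex (\<lambda>U. sym_conj n w U a a * cnj (sym_conj n w U a a)) = sym_diag w"
    unfolding sym_diag_def using \<sigma> pos
    by (subst (2) Ex_invariant[OF unitary_perm_mat[OF \<sigma>(1)], symmetric])
       (auto intro!: bobs simp: conj_perm_mat)
qed

lemma Ex_phase_odd_eq_0:
  assumes "bounded_obs n f" "\<And>i. cnj (d i) * d i = 1"
    "\<And>U. f (cmul n (phase_mat n d) U) = - f U"
  shows "Ex f = 0"
  using Ex_odd_eq_0[OF unitary_phase_mat assms(1)] assms by auto

section \<open>Linear equations between the moments\<close>

lemma herm_frobenius:
  "of_nat n * herm_diag w + of_nat n * (of_nat n - 1) * herm_off w = of_real (\<Sum>l<n. (w l)\<^sup>2)"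
proof -
  have "of_real (\<Sum>l<n. (w l)\<^sup>2) =
      Ex (\<lambda>U. \<Sum>a<n. \<Sum>b<n. herm_conj n w U a b * cnj (herm_conj n w U a b))"
    by (intro Ex_AE_const[symmetric] bobs frobenius_herm_conj) auto
  also have "\<dots> = (\<Sum>a<n. \<Sum>b<n. Ex (\<lambda>U. herm_conj n w U a b * cnj (herm_conj n w U a b)))"
    by (subst Ex_sum, (intro bobs; simp), intro sum.cong refl Ex_sum bobs) auto
  also have "\<dots> = of_nat n * herm_diag w + of_nat n * (of_nat n - 1) * herm_off w"
    by (intro sum_off_diagonal(2) moments_diag moments_off)
  finally show ?thesis by simp
qed

lemma sym_frobenius:
  "of_nat n * sym_diag w + of_nat n * (of_nat n - 1) * sym_off w = of_real (\<Sum>l<n. (w l)\<^sup>2)"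
proof -
  have "of_real (\<Sum>l<n. (w l)\<^sup>2) =
      Ex (\<lambda>U. \<Sum>a<n. \<Sum>b<n. sym_conj n w U a b * cnj (sym_conj n w U a b))"
    by (intro Ex_AE_const[symmetric] bobs frobenius_sym_conj) auto
  also have "\<dots> = (\<Sum>a<n. \<Sum>b<n. Ex (\<lambda>U. sym_conj n w U a b * cnj (sym_conj n w U a b)))"
    by (subst Ex_sum, (intro bobs; simp), intro sum.cong refl Ex_sum bobs) auto
  also have "\<dots> = of_nat n * sym_diag w + of_nat n * (of_nat n - 1) * sym_off w"
    by (intro sum_off_diagonal(2) moments_diag moments_off)
  finally show ?thesis by simp
qed

text \<open>The squared trace is deterministic, and its expansion into pairs of diagonal entries
  involves only \<open>herm_diag\<close> and \<open>herm_cross\<close>.\<close>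

lemma herm_trace:
  "of_nat n * herm_diag w + of_nat n * (of_nat n - 1) * herm_cross w = of_real ((\<Sum>l<n. w l)\<^sup>2)"
proof -
  have "of_real ((\<Sum>l<n. w l)\<^sup>2) =
      Ex (\<lambda>U. \<Sum>a<n. \<Sum>b<n. herm_conj n w U a a * cnj (herm_conj n w U b b))"
  proof (intro Ex_AE_const[symmetric])
    fix U assume U: "unitary_mat n U"
    have "(\<Sum>a<n. \<Sum>b<n. herm_conj n w U a a * cnj (herm_conj n w U b b)) =
      (\<Sum>a<n. herm_conj n w U a a) * cnj (\<Sum>a<n. herm_conj n w U a a)"
      by (simp add: sum_product)
    then show "(\<Sum>a<n. \<Sum>b<n. herm_conj n w U a a * cnj (herm_conj n w U b b)) = of_real ((\<Sum>l<n. w l)\<^sup>2)"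
      using trace_herm_conj[OF U] by (simp add: power2_eq_square)
  qed (intro bobs; simp)
  also have "\<dots> = (\<Sum>a<n. \<Sum>b<n. Ex (\<lambda>U. herm_conj n w U a a * cnj (herm_conj n w U b b)))"
    by (subst Ex_sum, (intro bobs; simp), intro sum.cong refl Ex_sum bobs) auto
  also have "\<dots> = of_nat n * herm_diag w + of_nat n * (of_nat n - 1) * herm_cross w"
    by (intro sum_off_diagonal(2) moments_diag moments_off)
  finally show ?thesis by simp
qed

lemma Ex_mult_cnj_add:
  assumes "bounded_obs n f" "bounded_obs n g"
  shows "Ex (\<lambda>U. (f U + g U) * cnj (f U + g U)) =
    Ex (\<lambda>U. f U * cnj (f U)) + Ex (\<lambda>U. g U * cnj (g U)) + Ex (\<lambda>U. f U * cnj (g U)) + Ex (\<lambda>U. g U * cnj (f U))"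
proof -
  have "Ex (\<lambda>U. (f U + g U) * cnj (f U + g U)) =
      Ex (\<lambda>U. f U * cnj (f U) + g U * cnj (g U) + f U * cnj (g U) + g U * cnj (f U))"
    by (intro Bochner_Integration.integral_cong refl) (simp add: algebra_simps)
  also have "\<dots> = Ex (\<lambda>U. f U * cnj (f U)) + Ex (\<lambda>U. g U * cnj (g U)) + Ex (\<lambda>U. f U * cnj (g U)) + Ex (\<lambda>U. g U * cnj (f U))"
    using assms by (simp add: Ex_add bobs)
  finally show ?thesis .
qed

text \<open>Rotation invariance replaces twice the entry (0,0) by the sum of a diagonal part and an
  off-diagonal part. The mixed terms vanish, and comparing squares gives 4 \<open>herm_diag\<close>
  = 2 \<open>herm_diag\<close> + 2 \<open>herm_cross\<close> + 2 \<open>herm_off\<close>.\<close>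

lemma herm_rotation: "herm_diag w = herm_cross w + herm_off w"
proof -
  let ?H = "herm_conj n w"
  let ?\<alpha> = "\<lambda>U. ?H U 0 0 + ?H U 1 1" and ?\<beta> = "\<lambda>U. ?H U 0 1 + ?H U 1 0"
  have b: "bounded_obs n ?\<alpha>" "bounded_obs n ?\<beta>" using pos by (auto intro!: bobs)
  have "4 * herm_diag w = Ex (\<lambda>U. (2 * ?H U 0 0) * cnj (2 * ?H U 0 0))"
    by (simp add: herm_diag_def flip: integral_mult_right_zero)
  also have "\<dots> = Ex (\<lambda>U. (?\<alpha> U + ?\<beta> U) * cnj (?\<alpha> U + ?\<beta> U))"
    using pos by (subst Ex_invariant[OF unitary_rot_mat[OF n2], symmetric])
      (auto intro!: bobs simp only: conj_rot_mat[OF n2])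
  also have "\<dots> = Ex (\<lambda>U. ?\<alpha> U * cnj (?\<alpha> U)) + Ex (\<lambda>U. ?\<beta> U * cnj (?\<beta> U)) +
      Ex (\<lambda>U. ?\<alpha> U * cnj (?\<beta> U)) + Ex (\<lambda>U. ?\<beta> U * cnj (?\<alpha> U))"
    by (rule Ex_mult_cnj_add[OF b])
  \<comment> \<open>Changing the sign of row 1 fixes the diagonal part and negates the off-diagonal
    part.\<close>
  also have "Ex (\<lambda>U. ?\<alpha> U * cnj (?\<beta> U)) = 0"
    using pos by (intro Ex_phase_odd_eq_0[where d = "\<lambda>i. if i = 1 then -1 else 1"] bobs b)
      (auto simp: conj_phase_mat algebra_simps)
  also have "Ex (\<lambda>U. ?\<beta> U * cnj (?\<alpha> U)) = 0"
    using pos by (intro Ex_phase_odd_eq_0[where d = "\<lambda>i. if i = 1 then -1 else 1"] bobs b)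
      (auto simp: conj_phase_mat algebra_simps)
  also have "Ex (\<lambda>U. ?\<alpha> U * cnj (?\<alpha> U)) = 2 * herm_diag w + 2 * herm_cross w"
    using pos by (subst Ex_mult_cnj_add) (auto intro!: bobs simp: moments_diag moments_off)
  also have "Ex (\<lambda>U. ?\<beta> U * cnj (?\<beta> U)) = 2 * herm_off w"
  proof -
    \<comment> \<open>Since the matrix is Hermitian, these integrands are squares of off-diagonal
      entries. The phase i on row 1 multiplies each such entry by i or -i, hence its square by
      -1.\<close>
    have "Ex (\<lambda>U. ?H U 0 1 * cnj (?H U 1 0)) = 0" "Ex (\<lambda>U. ?H U 1 0 * cnj (?H U 0 1)) = 0"
      using pos by (auto intro!: Ex_phase_odd_eq_0[where d = "\<lambda>i. if i = 1 then \<i> else 1"] bobs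
          simp: conj_phase_mat algebra_simps)
    then show ?thesis
      using pos by (subst Ex_mult_cnj_add) (auto intro!: bobs simp: moments_off)
  qed
  finally have "2 * herm_diag w = 2 * (herm_cross w + herm_off w)" by (simp add: distrib_left)
  then show ?thesis by (simp only: mult_cancel_left) simp
qed

text \<open>The same computation with the roles exchanged: distinct diagonal entries are now
  uncorrelated, while the two off-diagonal entries coincide by symmetry and reinforce each other.
  This gives 4 \<open>sym_diag\<close> = 2 \<open>sym_diag\<close> + 4
  \<open>sym_off\<close>.\<close>

lemma sym_rotation: "sym_diag w = 2 * sym_off w"
proof -
  let ?H = "sym_conj n w"
  let ?\<alpha> = "\<lambda>U. ?H U 0 0 + ?H U 1 1" and ?\<beta> = "\<lambda>U. 2 * ?H U 0 1"
  have b: "bounded_obs n ?\<alpha>" "bounded_obs n ?\<beta>" using pos by (auto intro!: bobs)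
  have four: "Ex (\<lambda>U. (2 * f U) * cnj (2 * f U)) = 4 * Ex (\<lambda>U. f U * cnj (f U))" for f
    by (simp flip: integral_mult_right_zero)
  have "4 * sym_diag w = Ex (\<lambda>U. (2 * ?H U 0 0) * cnj (2 * ?H U 0 0))"
    by (simp only: four sym_diag_def)
  also have "\<dots> = Ex (\<lambda>U. (?\<alpha> U + ?\<beta> U) * cnj (?\<alpha> U + ?\<beta> U))"
    using pos by (subst Ex_invariant[OF unitary_rot_mat[OF n2], symmetric])
      (auto intro!: bobs simp only: conj_rot_mat[OF n2])
  also have "\<dots> = Ex (\<lambda>U. ?\<alpha> U * cnj (?\<alpha> U)) + Ex (\<lambda>U. ?\<beta> U * cnj (?\<beta> U)) +
      Ex (\<lambda>U. ?\<alpha> U * cnj (?\<beta> U)) + Ex (\<lambda>U. ?\<beta> U * cnj (?\<alpha> U))"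
    by (rule Ex_mult_cnj_add[OF b])
  also have "Ex (\<lambda>U. ?\<alpha> U * cnj (?\<beta> U)) = 0"
    using pos by (intro Ex_phase_odd_eq_0[where d = "\<lambda>i. if i = 1 then -1 else 1"] bobs b)
      (auto simp: conj_phase_mat algebra_simps)
  also have "Ex (\<lambda>U. ?\<beta> U * cnj (?\<alpha> U)) = 0"
    using pos by (intro Ex_phase_odd_eq_0[where d = "\<lambda>i. if i = 1 then -1 else 1"] bobs b)
      (auto simp: conj_phase_mat algebra_simps)
  also have "Ex (\<lambda>U. ?\<beta> U * cnj (?\<beta> U)) = 4 * sym_off w"
    by (simp only: four sym_off_def)
  also have "Ex (\<lambda>U. ?\<alpha> U * cnj (?\<alpha> U)) = 2 * sym_diag w"
  proof -
    \<comment> \<open>The phase i on row 1 enters the entry (1,1) twice and negates it, but leaves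
      the entry (0,0) fixed.\<close>
    have "Ex (\<lambda>U. ?H U 0 0 * cnj (?H U 1 1)) = 0" "Ex (\<lambda>U. ?H U 1 1 * cnj (?H U 0 0)) = 0"
      using pos by (auto intro!: Ex_phase_odd_eq_0[where d = "\<lambda>i. if i = 1 then \<i> else 1"] bobs
          simp: conj_phase_mat algebra_simps)
    then show ?thesis
      using pos by (subst Ex_mult_cnj_add) (auto intro!: bobs simp: moments_diag)
  qed
  finally show ?thesis by simp
qed

section \<open>Real values and bounds for the moments\<close>

lemma Ex_mult_cnj_real:
  obtains r where "r \<ge> 0" "Ex (\<lambda>U. f U * cnj (f U)) = complex_of_real r"
proof
  show "Ex (\<lambda>U. f U * cnj (f U)) = complex_of_real (\<integral>U. (cmod (f U))\<^sup>2 \<partial>\<mu>)"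
    by (simp only: complex_norm_square[symmetric] integral_complex_of_real)
qed auto

text \<open>The rotation relation eliminates \<open>herm_cross\<close> as \<open>D - G\<close>. The
  Frobenius relation then yields the inequality by dropping \<open>n * D >= 0\<close>, and the trace
  relation yields the last equation.\<close>

lemma herm_moments:
  obtains D G :: real where "herm_diag w = of_real D" "herm_off w = of_real G"
    "G \<ge> 0" "real n * (real n - 1) * G \<le> (\<Sum>l<n. (w l)\<^sup>2)"
    "(real n)\<^sup>2 * D = (\<Sum>l<n. w l)\<^sup>2 + real n * (real n - 1) * G"
proof -
  obtain D where D: "D \<ge> 0" "herm_diag w = of_real D"
    unfolding herm_diag_def by (rule Ex_mult_cnj_real)
  obtain G where G: "G \<ge> 0" "herm_off w = of_real G"
    unfolding herm_off_def by (rule Ex_mult_cnj_real)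
  have cross: "herm_cross w = of_real (D - G)"
    using herm_rotation[of w] D G by simp
  have "complex_of_real (real n * D + real n * (real n - 1) * G) = of_real (\<Sum>l<n. (w l)\<^sup>2)"
    using herm_frobenius[of w] D G by simp
  then have 1: "real n * D + real n * (real n - 1) * G = (\<Sum>l<n. (w l)\<^sup>2)"
    by (simp only: of_real_eq_iff)
  have "complex_of_real (real n * D + real n * (real n - 1) * (D - G)) = of_real ((\<Sum>l<n. w l)\<^sup>2)"
    using herm_trace[of w] D cross by simp
  then have 2: "real n * D + real n * (real n - 1) * (D - G) = (\<Sum>l<n. w l)\<^sup>2"
    by (simp only: of_real_eq_iff)
  have "real n * D \<ge> 0" using D by simp
  then have "real n * (real n - 1) * G \<le> (\<Sum>l<n. (w l)\<^sup>2)" using 1 by linarith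
  moreover have "(real n)\<^sup>2 * D = (\<Sum>l<n. w l)\<^sup>2 + real n * (real n - 1) * G"
    using 2 by (simp add: algebra_simps power2_eq_square)
  ultimately show ?thesis
    using D G by (intro that[of D G]) auto
qed

text \<open>The Frobenius relation even fixes \<open>n * (n + 1) * G\<close>; the weaker bound is
  stated to match the Hermitian case.\<close>

lemma sym_moments:
  obtains G :: real where "sym_diag w = of_real (2 * G)" "sym_off w = of_real G"
    "G \<ge> 0" "real n * (real n - 1) * G \<le> (\<Sum>l<n. (w l)\<^sup>2)"
proof -
  obtain G where G: "G \<ge> 0" "sym_off w = of_real G"
    unfolding sym_off_def by (rule Ex_mult_cnj_real)
  have diag: "sym_diag w = of_real (2 * G)"
    using sym_rotation[of w] G by simp
  have "complex_of_real (real n * (2 * G) + real n * (real n - 1) * G) = of_real (\<Sum>l<n. (w l)\<^sup>2)"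
    using sym_frobenius[of w] G diag by simp
  then have 1: "real n * (2 * G) + real n * (real n - 1) * G = (\<Sum>l<n. (w l)\<^sup>2)"
    by (simp only: of_real_eq_iff)
  have "real n * (2 * G) \<ge> 0" using G by simp
  then have "real n * (real n - 1) * G \<le> (\<Sum>l<n. (w l)\<^sup>2)" using 1 by linarith
  then show ?thesis
    using G diag by (intro that[of G]) auto
qed

section \<open>Expectations of the linear and antilinear parts\<close>

lemma Ex_linear_part:
  assumes "i < k" "j < k" "k \<le> n"
  shows "Ex (\<lambda>U. \<Sum>l<k. herm_conj n p U i l * herm_conj n p U l j - sym_conj n q U i l * cnj (sym_conj n q U l j))
    = (if i = j then herm_diag p + (of_nat k - 1) * herm_off p - (sym_diag q + (of_nat k - 1) * sym_off q) else 0)"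
proof (cases "i = j")
  case False
  \<comment> \<open>The phases of the summation index \<open>l\<close> cancel in every product, so a
    sign change of row \<open>i\<close> alone negates each summand.\<close>
  have "Ex (\<lambda>U. \<Sum>l<k. herm_conj n p U i l * herm_conj n p U l j - sym_conj n q U i l * cnj (sym_conj n q U l j)) = 0"
  proof (rule Ex_phase_odd_eq_0[where d = "\<lambda>a. if a = i then -1 else 1"])
    show "bounded_obs n (\<lambda>U. \<Sum>l<k. herm_conj n p U i l * herm_conj n p U l j - sym_conj n q U i l * cnj (sym_conj n q U l j))"
      using assms by (intro bobs) auto
  qed (use assms False in \<open>auto simp: conj_phase_mat simp flip: sum_negf intro!: sum.cong\<close>)
  then show ?thesis using False by simp
next
  case True
  \<comment> \<open>On the diagonal, the Hermitian and symmetric structures turn the products into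
    squared moduli: one diagonal moment (\<open>l = i\<close>) and \<open>k - 1\<close> off-diagonal
    ones.\<close>
  have "Ex (\<lambda>U. \<Sum>l<k. herm_conj n p U i l * herm_conj n p U l i - sym_conj n q U i l * cnj (sym_conj n q U l i))
    = Ex (\<lambda>U. (\<Sum>l<k. herm_conj n p U i l * cnj (herm_conj n p U i l)) - (\<Sum>l<k. sym_conj n q U i l * cnj (sym_conj n q U i l)))"
    by (simp add: cnj_herm_conj sum_subtractf sym_conj_commute[of n q _ i])
  also have "\<dots> = (\<Sum>l<k. Ex (\<lambda>U. herm_conj n p U i l * cnj (herm_conj n p U i l))) -
      (\<Sum>l<k. Ex (\<lambda>U. sym_conj n q U i l * cnj (sym_conj n q U i l)))"
    using assms by (subst Ex_diff, (intro bobs; simp)+, subst (1 2) Ex_sum) (auto intro!: bobs)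
  also have "(\<Sum>l<k. Ex (\<lambda>U. herm_conj n p U i l * cnj (herm_conj n p U i l)))
      = herm_diag p + (of_nat k - 1) * herm_off p"
    using assms by (intro sum_off_diagonal(1) moments_diag moments_off) auto
  also have "(\<Sum>l<k. Ex (\<lambda>U. sym_conj n q U i l * cnj (sym_conj n q U i l)))
      = sym_diag q + (of_nat k - 1) * sym_off q"
    using assms by (intro sum_off_diagonal(1) moments_diag moments_off) auto
  finally show ?thesis using True by simp
qed

text \<open>Each summand has exactly one symmetric factor, which the global phase i negates while
  fixing the Hermitian factor.\<close>

lemma Ex_antilinear_part:
  assumes "i < k" "j < k" "k \<le> n"
  shows "Ex (\<lambda>U. \<Sum>l<k. herm_conj n p U i l * sym_conj n q U l j - sym_conj n q U i l * cnj (herm_conj n p U l j)) = 0"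
proof (rule Ex_phase_odd_eq_0[where d = "\<lambda>a. \<i>"])
  show "bounded_obs n (\<lambda>U. \<Sum>l<k. herm_conj n p U i l * sym_conj n q U l j - sym_conj n q U i l * cnj (herm_conj n p U l j))"
    using assms by (intro bobs) auto
qed (use assms in \<open>auto simp: conj_phase_mat simp flip: sum_negf intro!: sum.cong\<close>)

end

section \<open>The reduced covariance matrix\<close>

text \<open>With \<open>z = exp r\<close> the two weights are cosh r and sinh r. Their sum is
  \<open>z\<close>, their difference is \<open>1 / z\<close>, and the mean of
  \<open>half_sum\<close> over the modes is the average energy.\<close>

definition half_sum :: "(nat \<Rightarrow> nat \<Rightarrow> real) \<Rightarrow> nat \<Rightarrow> nat \<Rightarrow> real" where
  "half_sum z n l = (z n l + 1 / z n l) / 2"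

definition half_diff :: "(nat \<Rightarrow> nat \<Rightarrow> real) \<Rightarrow> nat \<Rightarrow> nat \<Rightarrow> real" where
  "half_diff z n l = (z n l - 1 / z n l) / 2"

lemma Mmat_eq_sum:
  "Mmat n z U a b = (\<Sum>l<n. eta n U a l * z n l * eta n U b l) +
     (\<Sum>l<n. eta n U a (n + l) * (1 / z n l) * eta n U b (n + l))"
proof -
  have *: "(\<Sum>c'<2*n. eta n U a c' * Zhat n z c' c) = eta n U a c * Zhat n z c c" if "c < 2*n" for c
  proof -
    have "(\<Sum>c'<2*n. eta n U a c' * Zhat n z c' c) = (\<Sum>c'<2*n. if c' = c then eta n U a c * Zhat n z c c else 0)"
      by (intro sum.cong) (auto simp: Zhat_def)
    then show ?thesis using that by simp
  qed
  have "Mmat n z U a b = (\<Sum>c<2*n. eta n U a c * Zhat n z c c * eta n U b c)"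
    unfolding Mmat_def rmul_def transp_r_def using * by (intro sum.cong) auto
  then show ?thesis
    by (simp add: sum_lessThan_double Zhat_def)
qed

text \<open>For x = \<open>U a l\<close> and y = \<open>U b l\<close>, the parts of x cnj(y) and of
  x y are sums and differences of the same products of real and imaginary parts. Weighting the
  former by \<open>half_sum\<close> and the latter by \<open>half_diff\<close> restores the
  coefficients \<open>z\<close> and \<open>1 / z\<close>.\<close>

lemma Mmat_blocks:
  fixes z n U
  defines "P \<equiv> herm_conj n (half_sum z n) U" and "Q \<equiv> sym_conj n (half_diff z n) U"
  assumes "a < n" "b < n"
  shows "Mmat n z U a b = Re (P a b) + Re (Q a b)"
    and "Mmat n z U a (n + b) = Im (P a b) - Im (Q a b)"
    and "Mmat n z U (n + a) b = - Im (P a b) - Im (Q a b)"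
    and "Mmat n z U (n + a) (n + b) = Re (P a b) - Re (Q a b)"
  using assms
  by (simp_all add: Mmat_eq_sum eta_def herm_conj_def sym_conj_def half_sum_def half_diff_def
      flip: sum.distrib sum_subtractf sum_negf)
    (intro sum.cong; simp add: field_simps)+

lemma Jmat_rmul:
  assumes "i < k" "c < 2 * k"
  shows "rmul (2*k) (Jmat k) M i c = - M (k + i) c"
    and "rmul (2*k) (Jmat k) M (k + i) c = M i c"
proof -
  have "rmul (2*k) (Jmat k) M i c = (\<Sum>l<2*k. if l = k + i then - M (k + i) c else 0)"
    unfolding rmul_def using assms by (intro sum.cong) (auto simp: Jmat_def)
  then show "rmul (2*k) (Jmat k) M i c = - M (k + i) c" using assms by simp
  have "rmul (2*k) (Jmat k) M (k + i) c = (\<Sum>l<2*k. if l = i then M i c else 0)"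
    unfolding rmul_def using assms by (intro sum.cong) (auto simp: Jmat_def)
  then show "rmul (2*k) (Jmat k) M (k + i) c = M i c" using assms by simp
qed

text \<open>Identify a real vector of length 2k with v = x + i y. Then \<open>A\<close> acts as v ->
  i cnj(P) v + i cnj(Q) cnj(v), with P and Q cut to the leading block. Applying it twice gives the
  linear part -cnj(S) and the antilinear part -cnj(X), and the four equations list the real blocks
  of that map.\<close>

lemma JM_square_blocks:
  fixes z n k U
  defines "P \<equiv> herm_conj n (half_sum z n) U" and "Q \<equiv> sym_conj n (half_diff z n) U"
    and "A \<equiv> rmul (2*k) (Jmat k) (Mred n k z U)"
  defines "S \<equiv> \<lambda>i j. \<Sum>l<k. P i l * P l j - Q i l * cnj (Q l j)"
    and "X \<equiv> \<lambda>i j. \<Sum>l<k. P i l * Q l j - Q i l * cnj (P l j)"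
  assumes "i < k" "j < k" "k \<le> n"
  shows "rmul (2*k) A A i j = - Re (S i j) - Re (X i j)"
    and "rmul (2*k) A A i (k + j) = - Im (S i j) + Im (X i j)"
    and "rmul (2*k) A A (k + i) j = Im (S i j) + Im (X i j)"
    and "rmul (2*k) A A (k + i) (k + j) = - Re (S i j) + Re (X i j)"
proof -
  have R: "Mred n k z U a b = Re (P a b) + Re (Q a b)"
    "Mred n k z U a (k + b) = Im (P a b) - Im (Q a b)"
    "Mred n k z U (k + a) b = - Im (P a b) - Im (Q a b)"
    "Mred n k z U (k + a) (k + b) = Re (P a b) - Re (Q a b)" if "a < k" "b < k" for a b
    using that assms(8) Mmat_blocks[of a n b z U] by (auto simp: Mred_def red_idx_def P_def Q_def)
  have A: "A a b = Im (P a b) + Im (Q a b)"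
    "A a (k + b) = - Re (P a b) + Re (Q a b)"
    "A (k + a) b = Re (P a b) + Re (Q a b)"
    "A (k + a) (k + b) = Im (P a b) - Im (Q a b)" if "a < k" "b < k" for a b
    using that by (simp_all add: A_def Jmat_rmul R)
  show "rmul (2*k) A A i j = - Re (S i j) - Re (X i j)"
    "rmul (2*k) A A i (k + j) = - Im (S i j) + Im (X i j)"
    "rmul (2*k) A A (k + i) j = Im (S i j) + Im (X i j)"
    "rmul (2*k) A A (k + i) (k + j) = - Re (S i j) + Re (X i j)"
    unfolding rmul_def sum_lessThan_double S_def X_def using assms(6,7)
    by (simp_all add: A flip: sum.distrib sum_subtractf sum_negf)
      (intro sum.cong; simp add: algebra_simps)+
qed

lemma (in haar_measure) integral_JM_square:
  fixes z k
  defines "p \<equiv> half_sum z n" and "q \<equiv> half_diff z n"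
  assumes "k \<le> n" "i < 2 * k" "j < 2 * k"
  shows "(\<integral>U. (let A = rmul (2 * k) (Jmat k) (Mred n k z U) in rmul (2 * k) A A i j) \<partial>\<mu>)
    = (if i = j then - Re (herm_diag p + (of_nat k - 1) * herm_off p - (sym_diag q + (of_nat k - 1) * sym_off q)) else 0)"
proof -
  define S where "S i j U = (\<Sum>l<k. herm_conj n p U i l * herm_conj n p U l j - sym_conj n q U i l * cnj (sym_conj n q U l j))" for i j U
  define X where "X i j U = (\<Sum>l<k. herm_conj n p U i l * sym_conj n q U l j - sym_conj n q U i l * cnj (herm_conj n p U l j))" for i j U
  define s where "s = herm_diag p + (of_nat k - 1) * herm_off p - (sym_diag q + (of_nat k - 1) * sym_off q)"
  obtain D G where DG: "herm_diag p = of_real D" "herm_off p = of_real G" by (rule herm_moments)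
  obtain H where H: "sym_diag q = of_real (2 * H)" "sym_off q = of_real H" by (rule sym_moments)
  \<comment> \<open>Realness of the moments removes the entries that couple coordinate
    \<open>a\<close> with coordinate \<open>k + a\<close>, so the expected matrix is scalar.\<close>
  have s: "Im s = 0" unfolding s_def DG H by simp
  have int: "integrable \<mu> (S a b)" "integrable \<mu> (X a b)" if "a < k" "b < k" for a b
    unfolding S_def X_def using that assms by (intro integrable_obs bobs; auto)+
  have ES: "integral\<^sup>L \<mu> (S a b) = (if a = b then s else 0)" if "a < k" "b < k" for a b
    using Ex_linear_part[OF that assms(3), of p q] by (simp add: S_def[abs_def] s_def)
  have EX: "integral\<^sup>L \<mu> (X a b) = 0" if "a < k" "b < k" for a b
    using Ex_antilinear_part[OF that assms(3), of p q] by (simp add: X_def[abs_def])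
  note blocks = JM_square_blocks[of _ k _ n z, OF _ _ assms(3), folded p_def q_def, folded S_def X_def]
  have split: "(a < k \<and> a' = a) \<or> (a < k \<and> a' = k + a)" if "a' < 2 * k" "a = (if a' < k then a' else a' - k)" for a a' :: nat
    using that by auto
  define a where "a = (if i < k then i else i - k)"
  define b where "b = (if j < k then j else j - k)"
  note ij = split[OF assms(4) a_def] split[OF assms(5) b_def]
  then have ab: "a < k" "b < k" by auto
  note I = int[OF ab] ES[OF ab] EX[OF ab]
  from ij ab consider "i = a" "j = b" | "i = a" "j = k + b" | "i = k + a" "j = b" | "i = k + a" "j = k + b"
    by blast
  then show ?thesis
    unfolding s_def[symmetric] Let_def
    using ab I s by cases (simp_all add: blocks)
qed

section \<open>The asymptotic estimate\<close>

theorem theorem1: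
  fixes z :: "nat \<Rightarrow> nat \<Rightarrow> real" and k :: "nat \<Rightarrow> nat"
    and \<zeta> \<kappa> :: real
    and \<mu> :: "nat \<Rightarrow> (nat \<Rightarrow> nat \<Rightarrow> complex) measure"
  assumes z_ge1: "\<And>n j. j < n \<Longrightarrow> z n j \<ge> 1"
    and zeta: "0 \<le> \<zeta>" "\<zeta> < 1"
    and squeezing: "\<exists>C>0. \<forall>\<^sub>F n in sequentially. (\<forall>j<n. \<bar>z n j\<bar> \<le> C * real n powr \<zeta>)"
    and energy_bdd: "\<exists>L. \<forall>n. \<bar>avg_energy z n\<bar> \<le> L"
    and k_range: "\<And>n. n \<ge> 1 \<Longrightarrow> 1 \<le> k n \<and> k n \<le> n"
    and kappa: "0 \<le> \<kappa>" "\<kappa> < 1"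
    and k_bdd: "\<exists>K>0. \<forall>\<^sub>F n in sequentially. real (k n) \<le> K * real n powr \<kappa>"
    and haar: "\<And>n. haar_unitary n (\<mu> n)"
  shows "\<exists>C. \<forall>\<^sub>F n in sequentially. \<exists>c. \<bar>c\<bar> \<le> C * real n powr (\<kappa> + \<zeta> - 1) \<and>
           (\<forall>i<2 * k n. \<forall>j<2 * k n.
              (\<integral>U. (let A = rmul (2 * k n) (Jmat (k n)) (Mred n (k n) z U)
                      in rmul (2 * k n) A A i j) \<partial>\<mu> n)
              = (if i = j then - (avg_energy z n)\<^sup>2 + c else 0))"
proof -
  obtain C where C: "C > 0" "\<forall>\<^sub>F n in sequentially. (\<forall>j<n. \<bar>z n j\<bar> \<le> C * real n powr \<zeta>)"
    using squeezing by blast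
  obtain L where L: "\<And>n. \<bar>avg_energy z n\<bar> \<le> L"
    using energy_bdd by blast
  obtain K where K: "K > 0" "\<forall>\<^sub>F n in sequentially. real (k n) \<le> K * real n powr \<kappa>"
    using k_bdd by blast
  \<comment> \<open>The constant comes from \<open>2 * k * (G + H)\<close>, with \<open>k\<close> at
    most \<open>K\<close> n^kappa and each of \<open>G\<close>, \<open>H\<close> at most
    \<open>2 * C * L\<close> n^(zeta - 1).\<close>
  have "\<forall>\<^sub>F n in sequentially. \<exists>c. \<bar>c\<bar> \<le> (8 * K * C * L) * real n powr (\<kappa> + \<zeta> - 1) \<and>
           (\<forall>i<2 * k n. \<forall>j<2 * k n.
              (\<integral>U. (let A = rmul (2 * k n) (Jmat (k n)) (Mred n (k n) z U)
                      in rmul (2 * k n) A A i j) \<partial>\<mu> n)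
              = (if i = j then - (avg_energy z n)\<^sup>2 + c else 0))"
    using C(2) K(2) eventually_ge_at_top[of 2]
  proof eventually_elim
    case (elim n)
    interpret haar_measure n "\<mu> n"
      using elim haar by unfold_locales auto
    define p where "p = half_sum z n"
    define q where "q = half_diff z n"
    define lam where "lam = avg_energy z n"
    obtain D G where DG: "herm_diag p = of_real D" "herm_off p = of_real G" "G \<ge> 0"
      "real n * (real n - 1) * G \<le> (\<Sum>l<n. (p l)\<^sup>2)"
      "(real n)\<^sup>2 * D = (\<Sum>l<n. p l)\<^sup>2 + real n * (real n - 1) * G"
      by (rule herm_moments)
    obtain H where H: "sym_diag q = of_real (2 * H)" "sym_off q = of_real H" "H \<ge> 0"
      "real n * (real n - 1) * H \<le> (\<Sum>l<n. (q l)\<^sup>2)"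
      by (rule sym_moments)
    \<comment> \<open>The exact deviation of the diagonal value from \<open>- lam^2\<close>.\<close>
    define c where "c = lam\<^sup>2 - (D + (real (k n) - 1) * G) + (2 * H + (real (k n) - 1) * H)"
    have n: "real n \<ge> 2" using elim by simp
    have kn: "1 \<le> real (k n)" "k n \<le> n" using k_range[of n] elim by auto
    have sum_p: "(\<Sum>l<n. p l) = real n * lam"
      using n by (simp add: lam_def avg_energy_def p_def half_sum_def field_simps flip: sum_divide_distrib)
    have p_bounds: "0 \<le> p l" "p l \<le> C * real n powr \<zeta>" "(q l)\<^sup>2 \<le> (p l)\<^sup>2" if "l < n" for l
    proof -
      have "z n l \<ge> 1" using z_ge1 that by simp
      define r where "r = 1 / z n l"
      have r: "0 < r" "r \<le> 1" using \<open>z n l \<ge> 1\<close> by (simp_all add: r_def field_simps)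
      have pq: "p l = (z n l + r) / 2" "q l = (z n l - r) / 2"
        by (simp_all add: p_def q_def half_sum_def half_diff_def r_def)
      show "0 \<le> p l" using r \<open>z n l \<ge> 1\<close> by (simp add: pq)
      have "p l \<le> z n l" using r \<open>z n l \<ge> 1\<close> by (simp add: pq)
      also have "\<dots> \<le> C * real n powr \<zeta>" using elim that by force
      finally show "p l \<le> C * real n powr \<zeta>" .
      have "\<bar>q l\<bar> \<le> \<bar>p l\<bar>"
        using r \<open>z n l \<ge> 1\<close> by (simp add: pq)
      then show "(q l)\<^sup>2 \<le> (p l)\<^sup>2" by (simp add: abs_le_square_iff)
    qed
    \<comment> \<open>In each square one factor is bounded by the squeezing and the other is summed
      with the energy bound. The order is thus n^(1 + zeta), and zeta enters only once.\<close>
    define B where "B = C * real n powr \<zeta> * (real n * L)"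
    have "(\<Sum>l<n. (p l)\<^sup>2) \<le> (\<Sum>l<n. C * real n powr \<zeta> * p l)"
      using p_bounds by (intro sum_mono) (auto simp: power2_eq_square intro!: mult_right_mono)
    also have "\<dots> = C * real n powr \<zeta> * (real n * lam)"
      by (simp add: sum_p flip: sum_distrib_left)
    also have "\<dots> \<le> B"
      unfolding B_def lam_def using C L[of n] by (intro mult_left_mono) auto
    finally have pB: "(\<Sum>l<n. (p l)\<^sup>2) \<le> B" .
    moreover have "(\<Sum>l<n. (q l)\<^sup>2) \<le> (\<Sum>l<n. (p l)\<^sup>2)"
      using p_bounds by (intro sum_mono) auto
    ultimately have qB: "(\<Sum>l<n. (q l)\<^sup>2) \<le> B" by simp
    \<comment> \<open>The factor 2 comes from \<open>n - 1 >= n / 2\<close>, valid for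
      \<open>n >= 2\<close>.\<close>
    have half: "x \<le> 2 * C * L * real n powr \<zeta> / real n" if "x \<ge> 0" "real n * (real n - 1) * x \<le> B" for x
    proof -
      have "real n * (real n / 2) * x \<le> real n * (real n - 1) * x"
        using n that by (intro mult_right_mono mult_left_mono) auto
      then have "real n * (real n / 2) * x \<le> C * real n powr \<zeta> * (real n * L)"
        using that unfolding B_def by linarith
      then have "real n * (real n * x) \<le> real n * (2 * C * L * real n powr \<zeta>)"
        by (simp add: mult_ac)
      then show ?thesis using n by (simp add: field_simps)
    qed
    have G: "G \<le> 2 * C * L * real n powr \<zeta> / real n" using half[of G] DG pB by linarith
    have H': "H \<le> 2 * C * L * real n powr \<zeta> / real n" using half[of H] H qB by linarith
    \<comment> \<open>Since the weights sum to \<open>n * lam\<close>, the trace relation isolates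
      \<open>D - lam^2\<close>, which lies between 0 and one off-diagonal moment.\<close>
    have "(real n)\<^sup>2 * (D - lam\<^sup>2) = real n * (real n - 1) * G"
      using DG(5) unfolding sum_p by (simp add: algebra_simps power2_eq_square)
    also have "\<dots> = (real n)\<^sup>2 * ((1 - 1 / real n) * G)"
      using n by (simp add: field_simps power2_eq_square)
    finally have D: "D - lam\<^sup>2 = (1 - 1 / real n) * G"
      using n by (simp only: mult_cancel_left) simp
    have D': "0 \<le> D - lam\<^sup>2" "D - lam\<^sup>2 \<le> G"
      unfolding D using n DG(3) by (auto intro!: mult_nonneg_nonneg mult_left_le_one_le)
    have kG: "0 \<le> (real (k n) - 1) * G" "0 \<le> (real (k n) - 1) * H"
      using kn DG H by auto
    have "\<bar>c\<bar> \<le> G + (real (k n) - 1) * G + 2 * H + (real (k n) - 1) * H"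
      unfolding c_def using D' kG H(3) DG(3) by linarith
    also have "\<dots> = real (k n) * G + real (k n) * H + H" by (simp add: algebra_simps)
    \<comment> \<open>The surplus \<open>H\<close>, due to the doubled diagonal moment in the
      symmetric case, is absorbed using \<open>k n >= 1\<close>.\<close>
    also have "\<dots> \<le> 2 * real (k n) * (G + H)"
    proof -
      have "H \<le> real (k n) * H" using kn H(3) by (simp add: mult_le_cancel_right1)
      moreover have "0 \<le> real (k n) * G" using DG by simp
      ultimately show ?thesis by (simp add: algebra_simps)
    qed
    also have "\<dots> \<le> 2 * (K * real n powr \<kappa>) * (4 * C * L * real n powr \<zeta> / real n)"
      using elim G H' DG(3) H(3) K(1) by (intro mult_mono) auto
    also have "\<dots> = (8 * K * C * L) * real n powr (\<kappa> + \<zeta> - 1)"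
      using n by (simp add: powr_diff powr_add)
    finally have "\<bar>c\<bar> \<le> (8 * K * C * L) * real n powr (\<kappa> + \<zeta> - 1)" .
    moreover have "(\<integral>U. (let A = rmul (2 * k n) (Jmat (k n)) (Mred n (k n) z U)
                      in rmul (2 * k n) A A i j) \<partial>\<mu> n)
              = (if i = j then - (avg_energy z n)\<^sup>2 + c else 0)" if "i < 2 * k n" "j < 2 * k n" for i j
      using integral_JM_square[OF kn(2) that, of z, folded p_def q_def]
      by (simp add: DG H c_def lam_def)
    ultimately show ?case by blast
  qed
  then show ?thesis by blast
qed

end
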